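(* For every $n\ge1$, the map $\eta$ defined below is a bijection of $\mathrm{And}_n^{I}$ onto $\mathrm{Alt}_n$, and $\mathbf{F}\,w=\mathbf{F}\,\eta(w)$ for every $w\in\mathrm{And}_n^{I}$.
   Context: Words $w=x_1\cdots x_n$ are permutations of finite sets $Y$ of positive integers; $C(w)=Y$, $|w|=n$, $e$ the empty word. Andr\'e I permutations: $e$ and one-letter words are Andr\'e I; for $|Y|\ge2$ write $w=v\,\min(w)\,v'$; $w$ is Andr\'e I if $v,v'$ are Andr\'e I and $\max(vv')$ is a letter of $v'$. $\mathrm{And}_n^{I}$: Andr\'e I permutations of $\{1,\dots,n\}$. $\mathrm{Alt}_n$: permutations $x_1\cdots x_n$ of $\{1,\dots,n\}$ with $x_1<x_2>x_3<x_4>\cdots$. $\mathbf{F}\,w=x_1$. Reduction: for a permutation $u$ of $Y$ with $|Y|=l$, $\rho(u)=\rho_Y(u)$ is obtained by replacing each letter by its rank in $Y$ (a permutation of $\{1,\dots,l\}$), and $\rho_Y^{-1}$ is the inverse relabeling of $\{1,\dots,l\}$ onto $Y$. For a permutation $u=u_1\cdots u_l$ of $\{1,\dots,l\}$, $\mathbf{c}(u)=(l+1-u_1)\cdots(l+1-u_l)$. Definition of $\eta$ (recursive): $\eta(1)=1$, $\eta(12)=12$, $\eta(123)=132$, $\eta(213)=231$. For $n\ge4$ and $w\in\mathrm{And}_n^{I}$ write $w=w'\,1\,w''$. If $w'=e$, put $v'=1$ and $v''=\rho_{C(w'')}^{-1}\,\mathbf{c}\,\eta\,\rho(w'')$. If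 $w'\ne e$, put $v'=\rho_{C(w')}^{-1}\,\eta\,\rho(w')$ and $v''=\rho_{C(1w'')}^{-1}\,\eta\,\rho(1\,w'')$ if $|w'|$ is even, $v''=\rho_{C(1w'')}^{-1}\,\mathbf{c}\,\eta\,\rho(1\,w'')$ if $|w'|$ is odd. Then $\eta(w)=v'v''$. *)

theory Defs
  imports "HOL-Combinatorics.Multiset_Permutations"
begin

text \<open>Words are lists of natural numbers. A permutation of a finite set \<open>Y\<close>, seen as a word, is
  an element of \<^term>\<open>permutations_of_set Y\<close>; the content of \<open>w\<close> is \<^term>\<open>set w\<close>.\<close>

definition is_word :: "nat list \<Rightarrow> bool" where
  "is_word w \<longleftrightarrow> distinct w \<and> (\<forall>x\<in>set w. 0 < x)"

inductive andre_I :: "nat list \<Rightarrow> bool" where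
  empty: "andre_I []"
| single: "is_word [x] \<Longrightarrow> andre_I [x]"
| step: "is_word w \<Longrightarrow> 2 \<le> length w \<Longrightarrow> w = v @ Min (set w) # v' \<Longrightarrow>
    andre_I v \<Longrightarrow> andre_I v' \<Longrightarrow> Max (set (v @ v')) \<in> set v' \<Longrightarrow> andre_I w"

definition And_I :: "nat \<Rightarrow> nat list set" where
  "And_I n = {w \<in> permutations_of_set {1..n}. andre_I w}"

text \<open>List positions are counted from 0, so the ascents are at the even positions.\<close>

definition Alt :: "nat \<Rightarrow> nat list set" where
  "Alt n = {w \<in> permutations_of_set {1..n}.
     \<forall>i. Suc i < n \<longrightarrow> (if even i then w ! i < w ! Suc i else w ! i > w ! Suc i)}"

definition rank :: "nat set \<Rightarrow> nat \<Rightarrow> nat" where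
  "rank Y x = card {y \<in> Y. y \<le> x}"

definition reduce :: "nat list \<Rightarrow> nat list" where
  "reduce u = map (rank (set u)) u"

definition unreduce :: "nat set \<Rightarrow> nat list \<Rightarrow> nat list" where
  "unreduce Y u = map (inv_into Y (rank Y)) u"

definition complement :: "nat list \<Rightarrow> nat list" where
  "complement u = map (\<lambda>x. length u + 1 - x) u"

lemma length_reduce [simp]: "length (reduce u) = length u"
  by (simp add: reduce_def)

text \<open>The value on lists that are not Andre I permutations of some \<open>{1..n}\<close> with \<open>n \<ge> 1\<close> is
  irrelevant. In the recursive case \<open>w = w' @ 1 # w''\<close>.\<close>

function eta :: "nat list \<Rightarrow> nat list" where
  "eta w =
    (if w = [1] then [1]
     else if w = [1, 2] then [1, 2]
     else if w = [1, 2, 3] then [1, 3, 2]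
     else if w = [2, 1, 3] then [2, 3, 1]
     else if 4 \<le> length w \<and> w \<in> And_I (length w) then
       (let w' = takeWhile (\<lambda>x. x \<noteq> 1) w;
            w'' = tl (dropWhile (\<lambda>x. x \<noteq> 1) w)
        in if w' = []
           then [1] @ unreduce (set w'') (complement (eta (reduce w'')))
           else unreduce (set w') (eta (reduce w')) @
             (if even (length w')
              then unreduce (set (1 # w'')) (eta (reduce (1 # w'')))
              else unreduce (set (1 # w'')) (complement (eta (reduce (1 # w''))))))
     else undefined)"
  by pat_completeness auto

lemma And_I_split:
  assumes "4 \<le> length w" "w \<in> And_I (length w)"
  shows "length w =
    Suc (length (takeWhile (\<lambda>x. x \<noteq> 1) w) + length (tl (dropWhile (\<lambda>x. x \<noteq> 1) w)))"
proof -
  have "1 \<in> set w"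
    using assms by (auto simp: And_I_def permutations_of_set_def)
  then have "dropWhile (\<lambda>x. x \<noteq> 1) w \<noteq> []"
    by (auto simp: dropWhile_eq_Nil_conv)
  moreover have "length w =
      length (takeWhile (\<lambda>x. x \<noteq> 1) w) + length (dropWhile (\<lambda>x. x \<noteq> 1) w)"
    by (metis length_append takeWhile_dropWhile_id)
  ultimately show ?thesis
    by (cases "dropWhile (\<lambda>x. x \<noteq> 1) w") auto
qed

termination eta
proof (relation "measure length", goal_cases)
  case 1
  show ?case by simp
qed (use And_I_split in \<open>fastforce simp: neq_Nil_conv\<close>)+

declare eta.simps [simp del]

end

theory Submission
  imports Defs
begin

text \<open>The recursion for \<open>\<eta>\<close> already holds for \<open>n \<ge> 2\<close>, so only \<open>n = 1\<close> is a base case. Write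
  \<open>w = w' 1 w''\<close> with \<open>w'\<close> nonempty; the letter \<open>n\<close> is in \<open>w''\<close>. By induction \<open>\<eta>\<close> preserves first
  letters, so the block \<open>v''\<close> built from \<open>1 w''\<close> starts with 1 if \<open>|w'|\<close> is even and, after
  complementation, with \<open>n\<close> if \<open>|w'|\<close> is odd. Hence \<open>v' v''\<close> alternates across the cut, and the cut
  is recovered from the image: it is just before the first occurrence of 1 or \<open>n\<close>. In any
  alternating word not starting with 1, the parity of the length of the part before that cut decides
  which of the two letters follows, so cutting there inverts the construction.\<close>

text \<open>The flag of \<open>zigzag\<close> says whether the word starts with an ascent.\<close>

fun zigzag :: "bool \<Rightarrow> nat list \<Rightarrow> bool" where
  "zigzag b (x # y # zs) \<longleftrightarrow> (if b then x < y else y < x) \<and> zigzag (\<not> b) (y # zs)"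
| "zigzag b w \<longleftrightarrow> True"

definition And_on :: "nat set \<Rightarrow> nat list set" where
  "And_on Y = {w \<in> permutations_of_set Y. andre_I w}"

definition Alt_on :: "bool \<Rightarrow> nat set \<Rightarrow> nat list set" where
  "Alt_on b Y = {w \<in> permutations_of_set Y. zigzag b w}"

text \<open>The flag has two meanings at once: it says whether complementation is skipped and,
  because values of \<open>eta\<close> are to open with an ascent, whether the image opens with an
  ascent. Every block in the recursion for \<open>eta\<close> is an instance.\<close>

definition eta_on :: "bool \<Rightarrow> nat set \<Rightarrow> nat list \<Rightarrow> nat list" where
  "eta_on b Y w =
    unreduce Y (if b then eta (reduce w) else complement (eta (reduce w)))"

section \<open>Alternating words under concatenation and relabeling\<close>

lemma zigzag_iff_nth:
  "zigzag b w \<longleftrightarrow>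
    (\<forall>i. Suc i < length w \<longrightarrow> (if even i = b then w ! i < w ! Suc i else w ! i > w ! Suc i))"
proof (induction b w rule: zigzag.induct)
  case (1 b x y zs)
  \<comment> \<open>Used to peel off index 0 on the right-hand side only; passing from
    \<open>i\<close> to \<open>Suc i\<close> flips the parity, which matches the negated
    flag.\<close>
  have split: "(\<forall>i. P i) \<longleftrightarrow> P 0 \<and> (\<forall>i. P (Suc i))" for P :: "nat \<Rightarrow> bool"
    by (metis nat.exhaust)
  show ?case
    unfolding zigzag.simps(1) 1
    by (subst (2) split) auto
qed auto

text \<open>The step across the cut has index \<open>length u - 1\<close> and the first step inside
  \<open>v\<close> has index \<open>length u\<close>. Their parities differ, so the same test
  \<open>even (length u) = b\<close> gives a descent at the cut and an ascent at the start of
  \<open>v\<close>.\<close>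

lemma zigzag_append:
  assumes "u \<noteq> []" "v \<noteq> []"
  shows "zigzag b (u @ v) \<longleftrightarrow> zigzag b u \<and>
    (if even (length u) = b then hd v < last u else last u < hd v) \<and>
    zigzag (even (length u) = b) v"
  using assms
proof (induction b u rule: zigzag.induct)
  case ("2_2" b x)
  then show ?case by (cases v) auto
next
  case (1 b x y zs)
  from 1(1)[OF _ 1(3)] show ?case by (cases b) simp_all
qed simp

lemma zigzag_map:
  assumes "strict_mono_on (set w) f"
  shows "zigzag b (map f w) \<longleftrightarrow> zigzag b w"
  using assms
proof (induction b w rule: zigzag.induct)
  case (1 b x y zs)
  have "strict_mono_on (set (y # zs)) f"
    using "1.prems" by (auto simp: monotone_on_def)
  with 1 show ?case
    by (simp add: strict_mono_on_less)
qed auto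

text \<open>Meant for the complement of letters, where truncated subtraction reverses the order on
  the letters of the word but not on all natural numbers.\<close>

lemma zigzag_map_flip:
  assumes "\<And>x y. x \<in> set w \<Longrightarrow> y \<in> set w \<Longrightarrow> f x < f y \<longleftrightarrow> y < x"
  shows "zigzag b (map f w) \<longleftrightarrow> zigzag (\<not> b) w"
  using assms
  by (induction b w rule: zigzag.induct) auto

lemma Alt_eq_Alt_on: "Alt n = Alt_on True {1..n}"
proof -
  have "length w = n" if "w \<in> permutations_of_set {1..n}" for w
    using that by (simp add: length_finite_permutations_of_set)
  then show ?thesis
    unfolding Alt_def Alt_on_def zigzag_iff_nth by auto
qed

lemma And_I_eq_And_on: "And_I n = And_on {1..n}"
  by (simp add: And_I_def And_on_def)

section \<open>Andre I words: factorization at the minimum and relabeling\<close>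

lemma andre_I_is_word: "andre_I w \<Longrightarrow> is_word w"
  by (induction rule: andre_I.induct) (auto simp: is_word_def)

text \<open>Trades \<open>Max\<close> for an upper bound inside \<open>v'\<close>, a form that
  carries over directly along a monotone map.\<close>

lemma Max_append_mem_right_iff:
  fixes v v' :: "nat list"
  shows "Max (set (v @ v')) \<in> set v' \<longleftrightarrow> (\<exists>z\<in>set v'. \<forall>x\<in>set (v @ v'). x \<le> z)"
proof
  assume "Max (set (v @ v')) \<in> set v'"
  then show "\<exists>z\<in>set v'. \<forall>x\<in>set (v @ v'). x \<le> z"
    by (meson List.finite_set Max_ge)
next
  assume "\<exists>z\<in>set v'. \<forall>x\<in>set (v @ v'). x \<le> z"
  then obtain z where "z \<in> set v'" "\<forall>x\<in>set (v @ v'). x \<le> z" by blast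
  then have "Max (set (v @ v')) = z"
    by (intro Max_eqI) auto
  with \<open>z \<in> set v'\<close> show "Max (set (v @ v')) \<in> set v'" by simp
qed

text \<open>The minimum \<open>m\<close> occurs only once, so the factorization around it is unique
  and the rule \<open>step\<close> can be inverted.\<close>

lemma andre_I_append_iff:
  assumes "is_word (v @ m # v')" "\<forall>x\<in>set (v @ v'). m < x" "v @ v' \<noteq> []"
  shows "andre_I (v @ m # v') \<longleftrightarrow>
    andre_I v \<and> andre_I v' \<and> (\<exists>z\<in>set v'. \<forall>x\<in>set (v @ v'). x \<le> z)"
proof -
  have m: "Min (set (v @ m # v')) = m"
    using assms(2) by (intro Min_eqI) (auto simp: less_imp_le)
  have d: "m \<notin> set v" "m \<notin> set v'"
    using assms(1) by (auto simp: is_word_def)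
  have len: "2 \<le> length (v @ m # v')"
    using assms(3) by (cases v; cases v') auto
  show ?thesis
  proof
    assume "andre_I (v @ m # v')"
    then show "andre_I v \<and> andre_I v' \<and> (\<exists>z\<in>set v'. \<forall>x\<in>set (v @ v'). x \<le> z)"
    proof cases
      case (step u u')
      then have "v @ m # v' = u @ m # u'" using m by metis
      then have "v = u \<and> v' = u'"
        using d step(1) unfolding is_word_def
        by (metis append_Cons_eq_iff)
      with step d Max_append_mem_right_iff show ?thesis by blast
    qed (use assms(3) in \<open>auto simp: append_eq_Cons_conv\<close>)
  next
    assume R: "andre_I v \<and> andre_I v' \<and> (\<exists>z\<in>set v'. \<forall>x\<in>set (v @ v'). x \<le> z)"
    show "andre_I (v @ m # v')"
    proof (rule andre_I.step[OF assms(1) len])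
      show "v @ m # v' = v @ Min (set (v @ m # v')) # v'"
        by (simp only: m)
      show "Max (set (v @ v')) \<in> set v'"
        using R Max_append_mem_right_iff by blast
    qed (use R in blast)+
  qed
qed

text \<open>A strictly increasing map keeps the place of the minimum and the side on which the
  maximum lies. Positivity of the values is what \<open>is_word\<close> demands of the
  image.\<close>

lemma andre_I_map:
  assumes "andre_I w" "strict_mono_on (set w) f" "\<forall>x\<in>set w. 0 < f x"
  shows "andre_I (map f w)"
  using assms
proof (induction rule: andre_I.induct)
  case empty
  show ?case by (simp add: andre_I.empty)
next
  case (single x)
  then show ?case by (auto intro: andre_I.single simp: is_word_def)
next
  case (step w v v')
  define m where "m = Min (set w)"
  have w: "w = v @ m # v'" using step.hyps(3) m_def by simp
  have dw: "distinct w" using step.hyps(1) by (simp add: is_word_def)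
  have le: "m \<le> x" if "x \<in> set w" for x
    using that by (simp add: m_def)
  have lt: "\<forall>x\<in>set (v @ v'). m < x"
    using le dw unfolding w by (fastforce simp: le_less)
  have nonempty: "v @ v' \<noteq> []" using step.hyps(2) w by auto
  have word: "is_word (map f w)"
    using dw step.prems strict_mono_on_imp_inj_on by (auto simp: is_word_def distinct_map)
  have "strict_mono_on (set v) f" "strict_mono_on (set v') f"
    using step.prems(1) w by (auto simp: monotone_on_def)
  then have IH: "andre_I (map f v)" "andre_I (map f v')"
    using step.IH step.prems(2) w by auto
  obtain z where z: "z \<in> set v'" "\<forall>x\<in>set (v @ v'). x \<le> z"
    using step.hyps(6) Max_append_mem_right_iff[of v v'] by blast
  have "\<forall>x\<in>set (v @ v'). f x \<le> f z"
    using z step.prems(1) w by (auto simp: strict_mono_on_less_eq)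
  moreover have "\<forall>x\<in>set (v @ v'). f m < f x"
    using lt step.prems(1) w by (auto simp: strict_mono_on_less)
  ultimately show ?case
    using andre_I_append_iff[of "map f v" "f m" "map f v'"] word IH nonempty z(1) w by auto
qed

section \<open>Order-preserving relabelings as bijections between sets of words\<close>

lemma bij_betw_map_permutations_of_set:
  assumes "bij_betw f A B"
  shows "bij_betw (map f) (permutations_of_set A) (permutations_of_set B)"
proof -
  have inj: "inj_on f A" and B: "B = f ` A"
    using assms by (auto simp: bij_betw_def)
  have "inj_on (map f) (permutations_of_set A)"
  proof (rule inj_onI)
    fix u v assume "u \<in> permutations_of_set A" "v \<in> permutations_of_set A" "map f u = map f v"
    then show "u = v"
      using inj map_inj_on[of f u v] by (simp add: permutations_of_set_def)
  qed
  then show ?thesis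
    unfolding B bij_betw_def by (simp add: permutations_of_set_image_inj[OF inj])
qed

lemma bij_betw_Collect_restrict:
  assumes "bij_betw f A B" "\<And>x. x \<in> A \<Longrightarrow> Q (f x) \<longleftrightarrow> P x"
  shows "bij_betw f {x \<in> A. P x} {y \<in> B. Q y}"
  using assms by (auto simp: bij_betw_def inj_on_def)

lemma strict_mono_on_inv_into:
  fixes f :: "nat \<Rightarrow> nat"
  assumes "strict_mono_on A f"
  shows "strict_mono_on (f ` A) (inv_into A f)"
proof (rule strict_mono_onI)
  fix x y assume *: "x \<in> f ` A" "y \<in> f ` A" "x < y"
  then have "f (inv_into A f x) < f (inv_into A f y)"
    by (simp add: f_inv_into_f)
  with * show "inv_into A f x < inv_into A f y"
    using strict_mono_on_less[OF assms] by (simp add: inv_into_into)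
qed

lemma bij_betw_map_And_on:
  assumes mono: "strict_mono_on A f" and B: "B = f ` A"
    and pos: "\<forall>x\<in>A. 0 < x" "\<forall>x\<in>B. 0 < x"
  shows "bij_betw (map f) (And_on A) (And_on B)"
  unfolding And_on_def
proof (rule bij_betw_Collect_restrict)
  have inj: "inj_on f A" using mono by (rule strict_mono_on_imp_inj_on)
  then show "bij_betw (map f) (permutations_of_set A) (permutations_of_set B)"
    using B by (intro bij_betw_map_permutations_of_set) (simp add: bij_betw_def)
  fix w assume "w \<in> permutations_of_set A"
  then have w: "set w = A" by (simp add: permutations_of_set_def)
  \<comment> \<open>The converse direction: relabel back along the inverse, which is again strictly
    increasing and takes its values in the positive set \<open>A\<close>.\<close>
  have "andre_I (map (inv_into A f) (map f w))" if "andre_I (map f w)"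
  proof (rule andre_I_map[OF that])
    show "strict_mono_on (set (map f w)) (inv_into A f)"
      using strict_mono_on_inv_into[OF mono] w by simp
    show "\<forall>x\<in>set (map f w). 0 < inv_into A f x"
      using pos(1) w inj by auto
  qed
  moreover have "map (inv_into A f) (map f w) = w"
    unfolding map_map using w inj by (intro map_idI) simp
  ultimately show "andre_I (map f w) \<longleftrightarrow> andre_I w"
    using andre_I_map[of w f] mono pos(2) w B by auto
qed

lemma bij_betw_map_Alt_on:
  assumes mono: "strict_mono_on A f" and B: "B = f ` A"
  shows "bij_betw (map f) (Alt_on b A) (Alt_on b B)"
  unfolding Alt_on_def
proof (rule bij_betw_Collect_restrict)
  show "bij_betw (map f) (permutations_of_set A) (permutations_of_set B)"
    using B strict_mono_on_imp_inj_on[OF mono]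
    by (intro bij_betw_map_permutations_of_set) (simp add: bij_betw_def)
qed (use mono in \<open>simp add: zigzag_map permutations_of_set_def\<close>)

section \<open>Rank, reduction and complement\<close>

lemma strict_mono_on_rank:
  assumes "finite Y"
  shows "strict_mono_on Y (rank Y)"
proof (rule strict_mono_onI)
  fix x y assume "x \<in> Y" "y \<in> Y" "x < y"
  then have "{z \<in> Y. z \<le> x} \<subset> {z \<in> Y. z \<le> y}" by force
  then show "rank Y x < rank Y y"
    unfolding rank_def using assms by (intro psubset_card_mono) auto
qed

text \<open>Ranks lie in the interval and are pairwise distinct, so counting gives equality.\<close>

lemma rank_image:
  assumes "finite Y"
  shows "rank Y ` Y = {1..card Y}"
proof (rule card_subset_eq)
  show "rank Y ` Y \<subseteq> {1..card Y}"
  proof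
    fix r assume "r \<in> rank Y ` Y"
    then obtain x where x: "x \<in> Y" "r = rank Y x" by blast
    have "card {x} \<le> rank Y x"
      unfolding rank_def using assms x(1) by (intro card_mono) auto
    moreover have "rank Y x \<le> card Y"
      unfolding rank_def using assms by (intro card_mono) auto
    ultimately show "r \<in> {1..card Y}" using x(2) by simp
  qed
  show "card (rank Y ` Y) = card {1..card Y}"
    using strict_mono_on_imp_inj_on[OF strict_mono_on_rank[OF assms]]
    by (simp add: card_image)
qed simp

lemma rank_Min:
  assumes "finite Y" "Y \<noteq> {}"
  shows "rank Y (Min Y) = 1"
proof -
  have "{y \<in> Y. y \<le> Min Y} = {Min Y}"
    using assms Min_in[of Y] Min_le[of Y] by (blast intro: antisym order_refl)
  then show ?thesis by (simp add: rank_def)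
qed

lemma rank_Max:
  assumes "finite Y"
  shows "rank Y (Max Y) = card Y"
proof -
  have "{y \<in> Y. y \<le> Max Y} = Y"
    using assms by auto
  then show ?thesis by (simp add: rank_def)
qed

lemma inv_into_rank:
  assumes "finite Y" "x \<in> Y"
  shows "inv_into Y (rank Y) (rank Y x) = x"
  using assms strict_mono_on_imp_inj_on[OF strict_mono_on_rank] by simp

lemma bij_betw_reduce_And_on:
  assumes "finite Y" "\<forall>x\<in>Y. 0 < x"
  shows "bij_betw reduce (And_on Y) (And_I (card Y))"
proof -
  have "bij_betw (map (rank Y)) (And_on Y) (And_on {1..card Y})"
    using assms rank_image[of Y] strict_mono_on_rank[of Y]
    by (intro bij_betw_map_And_on) auto
  \<comment> \<open>\<open>reduce\<close> takes ranks in the content of its own argument, which for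
    these words is \<open>Y\<close>.\<close>
  moreover have "reduce w = map (rank Y) w" if "w \<in> And_on Y" for w
    using that by (simp add: reduce_def And_on_def permutations_of_set_def)
  ultimately show ?thesis
    unfolding And_I_eq_And_on using bij_betw_cong by blast
qed

lemma bij_betw_unreduce_Alt_on:
  assumes "finite Y"
  shows "bij_betw (unreduce Y) (Alt_on b {1..card Y}) (Alt_on b Y)"
proof -
  have inj: "inj_on (rank Y) Y"
    using strict_mono_on_imp_inj_on[OF strict_mono_on_rank[OF assms]] .
  have "bij_betw (map (inv_into Y (rank Y))) (Alt_on b (rank Y ` Y)) (Alt_on b Y)"
    using strict_mono_on_inv_into[OF strict_mono_on_rank[OF assms]] inj
    by (intro bij_betw_map_Alt_on) (auto simp: image_image)
  then show ?thesis
    by (simp add: rank_image[OF assms] unreduce_def[abs_def])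
qed

text \<open>The involution \<open>x\<close> to \<open>n + 1 - x\<close> of \<open>{1..n}\<close>
  reverses the order and so exchanges ascents and descents.\<close>

lemma bij_betw_complement: "bij_betw complement (Alt_on True {1..n}) (Alt_on False {1..n})"
proof -
  let ?f = "\<lambda>x. n + 1 - x"
  have "bij_betw ?f {1..n} {1..n}"
    by (rule bij_betw_byWitness[where f' = ?f]) auto
  then have "bij_betw (map ?f) (Alt_on True {1..n}) (Alt_on False {1..n})"
    unfolding Alt_on_def
    by (intro bij_betw_Collect_restrict bij_betw_map_permutations_of_set,
        assumption, subst zigzag_map_flip) (auto simp: permutations_of_set_def)
  \<comment> \<open>\<open>complement\<close> reads its constant off the length of the word, which
    is \<open>n\<close> here.\<close>
  moreover have "complement w = map ?f w" if "w \<in> Alt_on True {1..n}" for w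
    using that by (auto simp: complement_def Alt_on_def dest!: length_finite_permutations_of_set)
  ultimately show ?thesis
    using bij_betw_cong by blast
qed

section \<open>Transport of \<open>eta\<close> to an alphabet \<open>Y\<close>, given both claims
  for size \<open>card Y\<close>\<close>

context
  fixes Y :: "nat set"
  assumes fin: "finite Y" and nonempty: "Y \<noteq> {}" and pos: "\<forall>x\<in>Y. 0 < x"
    and bij: "bij_betw eta (And_I (card Y)) (Alt (card Y))"
    and hd_eta: "\<forall>w\<in>And_I (card Y). hd w = hd (eta w)"
begin

text \<open>A composition of bijections: reduction, \<open>eta\<close>, complement if the flag is
  false, and relabeling by \<open>Y\<close>.\<close>

lemma bij_betw_eta_on: "bij_betw (eta_on b Y) (And_on Y) (Alt_on b Y)"
proof -
  have *: "bij_betw (eta \<circ> reduce) (And_on Y) (Alt_on True {1..card Y})"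
    using bij_betw_trans[OF bij_betw_reduce_And_on[OF fin pos] bij]
    by (simp add: Alt_eq_Alt_on)
  show ?thesis
  proof (cases b)
    case True
    with bij_betw_trans[OF * bij_betw_unreduce_Alt_on[OF fin]] show ?thesis
      by (simp add: eta_on_def[abs_def] comp_def)
  next
    case False
    with bij_betw_trans[OF bij_betw_trans[OF * bij_betw_complement]
        bij_betw_unreduce_Alt_on[OF fin]]
    show ?thesis
      by (simp add: eta_on_def[abs_def] comp_def)
  qed
qed

lemma hd_eta_reduce:
  assumes "w \<in> And_on Y"
  shows "hd (eta (reduce w)) = rank Y (hd w)" "eta (reduce w) \<noteq> []"
    "length (eta (reduce w)) = card Y"
proof -
  have r: "reduce w \<in> And_I (card Y)"
    using bij_betw_apply[OF bij_betw_reduce_And_on[OF fin pos] assms] .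
  have w: "set w = Y" "w \<noteq> []"
    using assms nonempty by (auto simp: And_on_def permutations_of_set_def)
  show "hd (eta (reduce w)) = rank Y (hd w)"
    using hd_eta r w by (metis hd_map reduce_def)
  have "eta (reduce w) \<in> Alt (card Y)"
    using bij_betw_apply[OF bij r] .
  then show len: "length (eta (reduce w)) = card Y"
    by (auto simp: Alt_def dest!: length_finite_permutations_of_set)
  with fin nonempty show "eta (reduce w) \<noteq> []"
    by auto
qed

lemma hd_eta_on_True:
  assumes "w \<in> And_on Y"
  shows "hd (eta_on True Y w) = hd w"
proof -
  have "hd w \<in> Y"
    using assms nonempty hd_in_set[of w] by (auto simp: And_on_def permutations_of_set_def)
  then show ?thesis
    using hd_eta_reduce[OF assms] by (simp add: eta_on_def unreduce_def hd_map inv_into_rank fin)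
qed

text \<open>Complementation turns the rank \<open>r\<close> of the first letter into
  \<open>card Y + 1 - r\<close>, which is the top rank exactly for \<open>r = 1\<close>. One
  direction finds the first letter of a block of the image, the other the first letter of a
  preimage.\<close>

lemma hd_eta_on_False:
  assumes "w \<in> And_on Y"
  shows "hd (eta_on False Y w) = Max Y \<longleftrightarrow> hd w = Min Y"
proof -
  have h: "hd w \<in> Y"
    using assms nonempty hd_in_set[of w] by (auto simp: And_on_def permutations_of_set_def)
  have r: "rank Y (hd w) \<in> {1..card Y}"
    using rank_image[OF fin] h by blast
  let ?k = "card Y + 1 - rank Y (hd w)"
  have k: "?k \<in> rank Y ` Y"
    using r unfolding rank_image[OF fin] by auto
  have "hd (eta_on False Y w) = inv_into Y (rank Y) ?k"
    using hd_eta_reduce[OF assms] by (simp add: eta_on_def unreduce_def complement_def hd_map)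
  also have "\<dots> = Max Y \<longleftrightarrow> ?k = rank Y (Max Y)"
    using k Max_in[OF fin nonempty] by (metis f_inv_into_f fin inv_into_rank)
  also have "\<dots> \<longleftrightarrow> rank Y (hd w) = rank Y (Min Y)"
    using r by (auto simp: rank_Max rank_Min fin nonempty)
  also have "\<dots> \<longleftrightarrow> hd w = Min Y"
    using h Min_in[OF fin nonempty] by (metis fin inv_into_rank)
  finally show ?thesis .
qed

end

section \<open>Explicit values for small alphabets\<close>

lemma reduce_unreduce_singleton: "reduce [a] = [1]" "unreduce {a} [1] = [a]"
proof -
  have "rank {a} a = 1" using rank_Min[of "{a}"] by simp
  then show "reduce [a] = [1]" "unreduce {a} [1] = [a]"
    using inv_into_rank[of "{a}" a] by (simp_all add: reduce_def unreduce_def)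
qed

lemma reduce_unreduce_pair:
  assumes "a < b"
  shows "reduce [a, b] = [1, 2]" "unreduce {a, b} [2, 1] = [b, a]"
proof -
  have "rank {a, b} a = 1" "rank {a, b} b = 2"
    using rank_Min[of "{a, b}"] rank_Max[of "{a, b}"] assms by simp_all
  then show "reduce [a, b] = [1, 2]" "unreduce {a, b} [2, 1] = [b, a]"
    using inv_into_rank[of "{a, b}" a] inv_into_rank[of "{a, b}" b]
    by (simp_all add: reduce_def unreduce_def)
qed

lemma eta_base: "eta [1] = [1]" "eta [1, 2] = [1, 2]" "eta [1, 2, 3] = [1, 3, 2]"
  "eta [2, 1, 3] = [2, 3, 1]"
  by (subst eta.simps, simp)+

text \<open>These blocks are the only ones that occur when the recursion is checked for
  \<open>n = 2\<close> and \<open>n = 3\<close>.\<close>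

lemma eta_on_base:
  "eta_on b {a} [a] = [a]"
  "a < c \<Longrightarrow> eta_on False {a, c} [a, c] = [c, a]"
  using reduce_unreduce_singleton reduce_unreduce_pair eta_base
  by (simp_all add: eta_on_def complement_def numeral_2_eq_2)

section \<open>Splitting a word at the letter 1, and the recursion for \<open>eta\<close>\<close>

lemma And_on_self: "w \<in> And_on (set w) \<longleftrightarrow> andre_I w"
  using andre_I_is_word[of w] by (auto simp: And_on_def permutations_of_set_def is_word_def)

text \<open>The factorization at the minimum with \<open>m = 1\<close>. As \<open>2 \<le> n\<close>,
  the largest of the other letters is \<open>n\<close>, so the condition on the maximum becomes
  \<open>n \<in> set w''\<close>.\<close>

lemma And_I_append_iff:
  assumes "2 \<le> n"
  shows "w' @ 1 # w'' \<in> And_I n \<longleftrightarrow> andre_I w' \<and> andre_I w'' \<and>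
    set w' \<inter> set w'' = {} \<and> set w' \<union> set w'' = {2..n} \<and> n \<in> set w''"
    (is "?L \<longleftrightarrow> ?R")
proof
  assume L: ?L
  then have d: "distinct (w' @ 1 # w'')" and s: "set (w' @ 1 # w'') = {1..n}"
    and a: "andre_I (w' @ 1 # w'')"
    by (auto simp: And_I_def permutations_of_set_def)
  have "set w' \<union> set w'' = set (w' @ 1 # w'') - {1}" using d by auto
  also have "\<dots> = {2..n}" unfolding s by auto
  finally have un: "set w' \<union> set w'' = {2..n}" .
  have "n \<in> set w' \<union> set w''" using assms unfolding un by simp
  then have ne: "w' @ w'' \<noteq> []" by auto
  have lt: "\<forall>x\<in>set (w' @ w''). 1 < x" using un by auto
  have *: "andre_I w' \<and> andre_I w'' \<and> (\<exists>z\<in>set w''. \<forall>x\<in>set (w' @ w''). x \<le> z)"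
    using andre_I_append_iff[OF andre_I_is_word[OF a] lt ne] a by simp
  then obtain z where z: "z \<in> set w''" "\<forall>x\<in>set w' \<union> set w''. x \<le> z" by auto
  have "n \<le> z" using z(2) \<open>n \<in> set w' \<union> set w''\<close> by blast
  moreover have "z \<in> {2..n}" using z(1) un by blast
  ultimately have "n \<in> set w''" using z(1) by simp
  with * d un show ?R by auto
next
  assume R: ?R
  have d: "distinct w'" "distinct w''"
    using R andre_I_is_word is_word_def by blast+
  have mem: "x \<in> {2..n}" if "x \<in> set w' \<or> x \<in> set w''" for x
    using R that by blast
  have s: "set (w' @ 1 # w'') = {1..n}" using R assms by auto
  have dd: "distinct (w' @ 1 # w'')"
    using R d mem by fastforce
  have "is_word (w' @ 1 # w'')"
    using dd s unfolding is_word_def by auto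
  moreover have "\<forall>x\<in>set (w' @ w''). 1 < x" using mem by fastforce
  moreover have "w' @ w'' \<noteq> []" using R by auto
  moreover have "\<forall>x\<in>set (w' @ w''). x \<le> n" using mem by fastforce
  ultimately have "andre_I (w' @ 1 # w'')"
    using andre_I_append_iff[of w' 1 w''] R by blast
  with dd s show ?L by (simp add: And_I_def permutations_of_set_def)
qed

text \<open>With an empty left part the maximum is on the right automatically. This makes
  \<open>1 # w''\<close> a legitimate argument for the second block.\<close>

lemma andre_I_Cons_1:
  assumes "w \<noteq> []" "\<forall>x\<in>set w. 1 < x"
  shows "andre_I (1 # w) \<longleftrightarrow> andre_I w"
proof -
  have "Max (set w) \<in> set w" "\<forall>x\<in>set w. x \<le> Max (set w)"
    using assms(1) by simp_all
  then have max: "\<exists>z\<in>set w. \<forall>x\<in>set w. x \<le> z" by blast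
  have "is_word (1 # w) \<longleftrightarrow> is_word w"
    using assms(2) by (auto simp: is_word_def)
  then show ?thesis
    using andre_I_append_iff[of "[]" 1 w] andre_I_is_word[of w] andre_I_is_word[of "1 # w"]
      assms max andre_I.empty by auto
qed

text \<open>For \<open>n = 2\<close> and \<open>n = 3\<close> all possible words are listed and
  compared with the explicit values; from 4 on this is the defining equation.\<close>

lemma eta_append:
  assumes n: "2 \<le> n" and w: "w' @ 1 # w'' \<in> And_I n"
  shows "eta (w' @ 1 # w'') =
    (if w' = [] then 1 # eta_on False (set w'') w''
     else eta_on True (set w') w' @
       eta_on (even (length w')) (set (1 # w'')) (1 # w''))"
proof -
  let ?w = "w' @ 1 # w''"
  have R: "andre_I w'" "andre_I w''" "set w' \<inter> set w'' = {}" "set w' \<union> set w'' = {2..n}"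
    "n \<in> set w''"
    using And_I_append_iff[OF n] w by auto
  have len: "length ?w = n"
    using w by (auto simp: And_I_def dest!: length_finite_permutations_of_set)
  have mem: "x \<in> {2..n}" if "x \<in> set w'" for x
    using that R(4) by blast
  then have "x \<noteq> 1" if "x \<in> set w'" for x
    using that by fastforce
  then have tw: "takeWhile (\<lambda>x. x \<noteq> 1) ?w = w'" and dw: "dropWhile (\<lambda>x. x \<noteq> 1) ?w = 1 # w''"
    by (simp_all add: takeWhile_append dropWhile_append)
  consider "n = 2" | "n = 3" | "4 \<le> n" using n by linarith
  then show ?thesis
  proof cases
    case 1
    then have "length w' + length w'' = 1" using len by simp
    moreover have "w'' \<noteq> []" using R(5) by auto
    ultimately have "w' = []" "length w'' = 1"
      by (cases w''; simp)+
    then obtain a where "w'' = [a]" by (auto simp: length_Suc_conv)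
    with R(5) 1 have "w'' = [2]" by simp
    with \<open>w' = []\<close> show ?thesis
      using eta_base(2) by (simp add: eta_on_base)
  next
    case 2
    then have l: "length w' + length w'' = 2" using len by simp
    moreover have "w'' \<noteq> []" using R(5) by auto
    ultimately consider "w' = []" "length w'' = 2" | "length w' = 1" "length w'' = 1"
      by (cases w'; cases w'') auto
    then show ?thesis
    proof cases
      case 1
      then obtain a b where ab: "w'' = [a, b]" by (auto simp: length_Suc_conv numeral_2_eq_2)
      have "set w'' = {2..3}" using R(4) 1(1) \<open>n = 3\<close> by simp
      also have "\<dots> = {2, 3}" by auto
      finally have "{a, b} = {2, 3}" by (simp only: ab list.set)
      then have "a = 2 \<and> b = 3 \<or> a = 3 \<and> b = 2" by (auto simp: doubleton_eq_iff)
      \<comment> \<open>The word 32 has nothing to the right of its minimum, which leaves 23 as the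
        only choice.\<close>
      moreover have "\<not> andre_I ([3] @ 2 # [])"
        by (subst andre_I_append_iff) (auto simp: is_word_def)
      ultimately have "w'' = [2, 3]" using R(2) ab by auto
      with 1 show ?thesis using eta_base(3) by (simp add: eta_on_base)
    next
      case 2
      then obtain a b where ab: "w' = [a]" "w'' = [b]" by (auto simp: length_Suc_conv)
      have "b = 3" using R(5) ab \<open>n = 3\<close> by simp
      moreover have "a = 2" using R(3) mem[of a] ab \<open>n = 3\<close> \<open>b = 3\<close> by auto
      ultimately show ?thesis using ab eta_base(4) by (simp add: eta_on_base)
    qed
  next
    case 3
    have "?w \<noteq> u" if "length u < 4" for u
      using that 3 len by auto
    then have "?w \<noteq> [1]" "?w \<noteq> [1, 2]" "?w \<noteq> [1, 2, 3]" "?w \<noteq> [2, 1, 3]"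
      by simp_all
    moreover have "4 \<le> length ?w \<and> ?w \<in> And_I (length ?w)"
      using 3 len w by simp
    ultimately show ?thesis
      using tw dw by (subst eta.simps) (simp add: Let_def eta_on_def)
  qed
qed

lemma zigzag_Cons_min:
  assumes "v \<noteq> []" "\<forall>y\<in>set v. x < y"
  shows "zigzag True (x # v) \<longleftrightarrow> zigzag False v"
  using assms by (cases v) auto

lemma And_I_obtain_split:
  assumes "1 \<le> n" "w \<in> And_I n"
  obtains w' w'' where "w = w' @ 1 # w''"
proof -
  have "1 \<in> set w" using assms by (simp add: And_I_def permutations_of_set_def)
  then show ?thesis using that by (metis split_list)
qed

lemma takeWhile_append_stop:
  assumes "\<forall>x\<in>set u. P x" "v \<noteq> []" "\<not> P (hd v)"
  shows "takeWhile P (u @ v) = u" "dropWhile P (u @ v) = v"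
  using assms by (cases v; simp add: takeWhile_append dropWhile_append)+

section \<open>The induction step for words on \<open>{1..n}\<close>\<close>

context
  fixes n :: nat
  assumes n: "2 \<le> n"
    and IH_bij: "\<And>m. 1 \<le> m \<Longrightarrow> m < n \<Longrightarrow> bij_betw eta (And_I m) (Alt m)"
    and IH_hd: "\<And>m. 1 \<le> m \<Longrightarrow> m < n \<Longrightarrow> \<forall>w\<in>And_I m. hd w = hd (eta w)"
begin

lemma proper_subset_facts:
  assumes "Y \<subset> {1..n}" "Y \<noteq> {}"
  shows "finite Y" "\<forall>x\<in>Y. 0 < x" "1 \<le> card Y" "card Y < n"
proof -
  show "finite Y" using assms(1) finite_subset by blast
  then show "1 \<le> card Y" using assms(2) by (simp add: Suc_le_eq card_gt_0_iff)
  show "\<forall>x\<in>Y. 0 < x" using assms(1) by fastforce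
  show "card Y < n" using psubset_card_mono[OF _ assms(1)] by simp
qed

text \<open>The induction hypothesis in the form used for blocks: a nonempty proper subset of
  \<open>{1..n}\<close> has at least 1 and fewer than \<open>n\<close> letters.\<close>

lemma eta_on_facts:
  assumes "Y \<subset> {1..n}" "Y \<noteq> {}"
  shows "bij_betw (eta_on b Y) (And_on Y) (Alt_on b Y)"
    and "w \<in> And_on Y \<Longrightarrow> hd (eta_on True Y w) = hd w"
    and "w \<in> And_on Y \<Longrightarrow> hd (eta_on False Y w) = Max Y \<longleftrightarrow> hd w = Min Y"
proof -
  note Y = proper_subset_facts[OF assms]
  note IH = IH_bij[OF Y(3,4)] IH_hd[OF Y(3,4)]
  show "bij_betw (eta_on b Y) (And_on Y) (Alt_on b Y)"
    by (rule bij_betw_eta_on[OF Y(1) assms(2) Y(2) IH])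
  show "hd (eta_on True Y w) = hd w" if "w \<in> And_on Y"
    by (rule hd_eta_on_True[OF Y(1) assms(2) Y(2) IH that])
  show "hd (eta_on False Y w) = Max Y \<longleftrightarrow> hd w = Min Y" if "w \<in> And_on Y"
    by (rule hd_eta_on_False[OF Y(1) assms(2) Y(2) IH that])
qed

lemma atLeast2_psubset: "{2..n} \<subset> {1..n}" "{2..n} \<noteq> {}"
  using n by force+

lemma psubset_if_subset_interior:
  assumes "Y \<subseteq> {1<..<n}"
  shows "Y \<subset> {1..n}"
proof -
  have "{1<..<n} \<subseteq> {1..n}" by auto
  moreover have "1 \<in> {1..n}" "1 \<notin> {1<..<n}" using n by auto
  ultimately show ?thesis using assms by blast
qed

lemma eta_Cons_1:
  assumes "1 # w'' \<in> And_I n"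
  shows "eta (1 # w'') = 1 # eta_on False {2..n} w''"
    and "w'' \<in> And_on {2..n}"
    and "eta_on False {2..n} w'' \<in> Alt_on False {2..n}"
proof -
  have R: "andre_I w''" "set w'' = {2..n}"
    using And_I_append_iff[OF n, of "[]" w''] assms by auto
  then show "w'' \<in> And_on {2..n}" using And_on_self by metis
  then show "eta_on False {2..n} w'' \<in> Alt_on False {2..n}"
    using bij_betw_apply[OF eta_on_facts(1)[OF atLeast2_psubset]] by blast
  show "eta (1 # w'') = 1 # eta_on False {2..n} w''"
    using eta_append[OF n, of "[]" w''] assms R(2) by simp
qed

text \<open>Collects what is known about the two blocks. Decisive is that the second one opens with
  1 or \<open>n\<close> while the first one avoids both letters: 1 is the place of the cut, and
  \<open>n\<close> lies in \<open>w''\<close>.\<close>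

lemma eta_append_parts:
  assumes w: "w' @ 1 # w'' \<in> And_I n" and ne: "w' \<noteq> []"
  defines "b \<equiv> even (length w')"
  defines "v' \<equiv> eta_on True (set w') w'"
    and "v'' \<equiv> eta_on b (set (1 # w'')) (1 # w'')"
  shows "eta (w' @ 1 # w'') = v' @ v''"
    and "v' \<in> Alt_on True (set w')" and "v'' \<in> Alt_on b (set (1 # w''))"
    and "hd v'' = (if b then 1 else n)" and "hd v' = hd w'"
    and "w' \<in> And_on (set w')" "1 # w'' \<in> And_on (set (1 # w''))"
    and "set w' \<subset> {1..n}" "set (1 # w'') \<subset> {1..n}"
    and "set w' \<subseteq> {1<..<n}" "set w' \<union> set (1 # w'') = {1..n}"
proof -
  have R: "andre_I w'" "andre_I w''" "set w' \<inter> set w'' = {}" "set w' \<union> set w'' = {2..n}"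
    "n \<in> set w''"
    using And_I_append_iff[OF n] w by auto
  have gt1: "1 < x" if "x \<in> set w' \<union> set w''" for x
    using that unfolding R(4) by simp
  have len: "x \<le> n" if "x \<in> set w' \<union> set w''" for x
    using that unfolding R(4) by simp
  show mid: "set w' \<subseteq> {1<..<n}"
  proof
    fix x assume x: "x \<in> set w'"
    then have "x \<noteq> n" using R(3,5) by blast
    with gt1[of x] len[of x] x show "x \<in> {1<..<n}" by simp
  qed
  show un: "set w' \<union> set (1 # w'') = {1..n}"
  proof -
    have "set w' \<union> set (1 # w'') = insert 1 (set w' \<union> set w'')" by simp
    also have "\<dots> = {1..n}" unfolding R(4) using n by auto
    finally show ?thesis .
  qed
  show p1: "set w' \<subset> {1..n}"
    using mid by (rule psubset_if_subset_interior)
  have "hd w' \<in> set w'" using ne by simp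
  \<comment> \<open>The first letter of \<open>w'\<close> is missing from the second alphabet, which
    is therefore proper and within reach of the induction hypothesis.\<close>
  then have "hd w' \<notin> set (1 # w'')" using R(3) gt1[of "hd w'"] by auto
  with \<open>hd w' \<in> set w'\<close> un show p2: "set (1 # w'') \<subset> {1..n}" by blast
  show a1: "w' \<in> And_on (set w')" using R(1) And_on_self by simp
  have "w'' \<noteq> []" using R(5) by auto
  then have "andre_I (1 # w'')"
    using andre_I_Cons_1[of w''] R(2) gt1 by simp
  then show a2: "1 # w'' \<in> And_on (set (1 # w''))" using And_on_self by blast
  have ne1: "set w' \<noteq> {}" and ne2: "set (1 # w'') \<noteq> {}" using ne by auto
  show "eta (w' @ 1 # w'') = v' @ v''"
    using eta_append[OF n w] ne by (simp add: v'_def v''_def b_def)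
  show "v' \<in> Alt_on True (set w')"
    unfolding v'_def by (rule bij_betw_apply[OF eta_on_facts(1)[OF p1 ne1] a1])
  show "v'' \<in> Alt_on b (set (1 # w''))"
    unfolding v''_def by (rule bij_betw_apply[OF eta_on_facts(1)[OF p2 ne2] a2])
  show "hd v' = hd w'"
    unfolding v'_def by (rule eta_on_facts(2)[OF p1 ne1 a1])
  show "hd v'' = (if b then 1 else n)"
  proof (cases b)
    case True
    then show ?thesis
      using eta_on_facts(2)[OF p2 ne2 a2] by (simp add: v''_def)
  next
    case False
    have "Min (set (1 # w'')) = 1"
      using gt1 by (intro Min_eqI) (auto simp: less_imp_le)
    moreover have "Max (set (1 # w'')) = n"
      using len R(5) n by (intro Max_eqI) auto
    ultimately show ?thesis
      using eta_on_facts(3)[OF p2 ne2 a2] False by (simp add: v''_def)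
  qed
qed

lemma hd_eta_step:
  assumes "w \<in> And_I n"
  shows "hd (eta w) = hd w"
proof -
  obtain w' w'' where w: "w = w' @ 1 # w''"
    using And_I_obtain_split[of n w] n assms by auto
  show ?thesis
  proof (cases "w' = []")
    case True
    then show ?thesis using eta_Cons_1(1) assms w by simp
  next
    case False
    note P = eta_append_parts[OF assms[unfolded w] False]
    have "eta_on True (set w') w' \<noteq> []"
      using P(2) False by (auto simp: Alt_on_def permutations_of_set_def)
    then show ?thesis using P(1,5) False w by simp
  qed
qed

lemma eta_in_Alt:
  assumes "w \<in> And_I n"
  shows "eta w \<in> Alt n"
proof -
  obtain w' w'' where w: "w = w' @ 1 # w''"
    using And_I_obtain_split[of n w] n assms by auto
  show ?thesis
  proof (cases "w' = []")
    case True
    define v where "v = eta_on False {2..n} w''"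
    have e: "eta w = 1 # v" and "v \<in> Alt_on False {2..n}"
      using eta_Cons_1 assms True w v_def by auto
    then have v: "set v = {2..n}" "distinct v" "zigzag False v"
      by (auto simp: Alt_on_def permutations_of_set_def)
    then have "zigzag True (1 # v)"
      using n by (subst zigzag_Cons_min) auto
    moreover have "set (1 # v) = {1..n}" using v(1) n by auto
    ultimately show ?thesis
      using v by (simp add: e Alt_eq_Alt_on Alt_on_def permutations_of_set_def)
  next
    case False
    define v' where "v' = eta_on True (set w') w'"
    define v'' where "v'' = eta_on (even (length w')) (set (1 # w'')) (1 # w'')"
    note P = eta_append_parts[OF assms[unfolded w] False, folded v'_def v''_def]
    have v': "set v' = set w'" "distinct v'" "zigzag True v'"
      using P(2) by (auto simp: Alt_on_def permutations_of_set_def)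
    have v'': "set v'' = set (1 # w'')" "distinct v''" "zigzag (even (length w')) v''"
      using P(3) by (auto simp: Alt_on_def permutations_of_set_def)
    have ne: "v' \<noteq> []" "v'' \<noteq> []" using v'(1) v''(1) False by auto
    have dw: "distinct (w' @ 1 # w'')"
      using assms w by (auto simp: And_I_def permutations_of_set_def)
    have len: "length v' = length w'"
      using v'(1,2) dw by (metis distinct_append distinct_card)
    \<comment> \<open>An inner letter lies above 1 and below \<open>n\<close>, so the step across
      the cut has the direction that the parity of \<open>length v'\<close> prescribes.\<close>
    have "last v' \<in> {1<..<n}" using ne(1) v'(1) P(10) last_in_set by blast
    then have "zigzag True (v' @ v'')"
      using zigzag_append[OF ne] v'(3) v''(3) P(4) len by auto
    moreover have "set (v' @ v'') = {1..n}"
      using P(11) v'(1) v''(1) by simp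
    moreover have "distinct (v' @ v'')"
      using dw v'(1,2) v''(1,2) by simp
    ultimately show ?thesis
      using P(1) w by (simp add: Alt_eq_Alt_on Alt_on_def permutations_of_set_def)
  qed
qed

lemma inj_on_eta_step: "inj_on eta (And_I n)"
proof (rule inj_onI)
  fix w u assume w: "w \<in> And_I n" and u: "u \<in> And_I n" and eq: "eta w = eta u"
  obtain w' w'' where ws: "w = w' @ 1 # w''"
    using And_I_obtain_split[of n w] n w by auto
  obtain u' u'' where us: "u = u' @ 1 # u''"
    using And_I_obtain_split[of n u] n u by auto
  \<comment> \<open>A word of \<open>And_I n\<close> has an empty left part exactly if it starts
    with 1, so equal first letters put \<open>w\<close> and \<open>u\<close> into the same case of
    the recursion.\<close>
  have hd: "hd w = hd u" using eq hd_eta_step w u by metis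
  have hd1: "x' = [] \<longleftrightarrow> hd (x' @ 1 # x'') = 1" if "x' @ 1 # x'' \<in> And_I n" for x' x''
    using that by (cases x') (auto simp: And_I_def permutations_of_set_def)
  have iff: "w' = [] \<longleftrightarrow> u' = []"
    using hd hd1[of w' w''] hd1[of u' u''] w u ws us by simp
  show "w = u"
  proof (cases "w' = []")
    case True
    then have "u' = []" using iff by simp
    have "1 # w'' \<in> And_I n" "1 # u'' \<in> And_I n"
      using w u ws us True \<open>u' = []\<close> by simp_all
    note W = eta_Cons_1[OF this(1)] and U = eta_Cons_1[OF this(2)]
    have "eta (1 # w'') = eta (1 # u'')"
      using eq ws us True \<open>u' = []\<close> by simp
    then have "eta_on False {2..n} w'' = eta_on False {2..n} u''"
      unfolding W(1) U(1) by simp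
    then have "w'' = u''"
      using bij_betw_imp_inj_on[OF eta_on_facts(1)[OF atLeast2_psubset]] W(2) U(2)
      by (blast dest: inj_onD)
    then show ?thesis using ws us True \<open>u' = []\<close> by simp
  next
    case False
    then have ne: "w' \<noteq> []" "u' \<noteq> []" using iff by auto
    \<comment> \<open>Scanning for the first 1 or \<open>n\<close> recovers both blocks from the
      image alone.\<close>
    let ?P = "\<lambda>x. x \<noteq> 1 \<and> x \<noteq> n"
    have cut: "takeWhile ?P (eta (x' @ 1 # x'')) = eta_on True (set x') x' \<and>
        dropWhile ?P (eta (x' @ 1 # x'')) =
          eta_on (even (length x')) (set (1 # x'')) (1 # x'')"
      if x: "x' @ 1 # x'' \<in> And_I n" and nx: "x' \<noteq> []" for x' x''
    proof -
      note P = eta_append_parts[OF x nx]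
      have "set (eta_on True (set x') x') = set x'"
        using P(2) by (simp add: Alt_on_def permutations_of_set_def)
      then have "\<forall>y\<in>set (eta_on True (set x') x'). ?P y"
        using P(10) by fastforce
      moreover have "eta_on (even (length x')) (set (1 # x'')) (1 # x'') \<noteq> []"
        using P(3) by (auto simp: Alt_on_def permutations_of_set_def)
      ultimately show ?thesis
        unfolding P(1) using P(4) by (intro conjI takeWhile_append_stop) auto
    qed
    note W = eta_append_parts[OF w[unfolded ws] ne(1)]
      and U = eta_append_parts[OF u[unfolded us] ne(2)]
    have e1: "eta_on True (set w') w' = eta_on True (set u') u'"
      and e2: "eta_on (even (length w')) (set (1 # w'')) (1 # w'') =
        eta_on (even (length u')) (set (1 # u'')) (1 # u'')"
      using cut[of w' w''] cut[of u' u''] w u ws us ne eq by metis+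
    have s1: "set w' = set u'"
      using W(2) U(2) e1 by (simp add: Alt_on_def permutations_of_set_def)
    have s2: "set (1 # w'') = set (1 # u'')"
      using W(3) U(3) e2 by (simp add: Alt_on_def permutations_of_set_def)
    have w': "w' = u'"
      using bij_betw_imp_inj_on[OF eta_on_facts(1)[OF W(8)], of True] W(6) U(6) e1 s1 ne
      by (auto dest: inj_onD)
    \<comment> \<open>Knowing \<open>w' = u'\<close> first makes the two flags equal, so
      \<open>e2\<close> compares values of one and the same injective map.\<close>
    have "1 # w'' = 1 # u''"
    proof (rule inj_onD)
      show "inj_on (eta_on (even (length w')) (set (1 # w''))) (And_on (set (1 # w'')))"
        using bij_betw_imp_inj_on[OF eta_on_facts(1)[OF W(9)]] by simp
    qed (use W(7) U(7) e2 s2 w' in simp_all)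
    then show ?thesis using w' ws us by simp
  qed
qed

text \<open>Both pieces of the cut word have preimages by the induction hypothesis. What remains is
  that the preimage of the second piece starts with 1, so that the two preimages glue to an Andre I
  word.\<close>

lemma eta_surj_step:
  assumes v: "v \<in> Alt n"
  shows "v \<in> eta ` And_I n"
proof -
  have sv: "set v = {1..n}" and dv: "distinct v" and zv: "zigzag True v"
    using v by (auto simp: Alt_eq_Alt_on Alt_on_def permutations_of_set_def)
  have lv: "length v = n" using dv sv distinct_card by fastforce
  show ?thesis
  proof (cases "hd v = 1")
    case True
    then obtain v'' where vs: "v = 1 # v''" using lv n by (cases v) auto
    have "set v'' = set v - {1}" using dv vs by auto
    also have "\<dots> = {2..n}" unfolding sv by auto
    finally have s: "set v'' = {2..n}" .
    then have "zigzag False v''"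
      using zv n unfolding vs by (subst (asm) zigzag_Cons_min) auto
    with s dv vs have "v'' \<in> Alt_on False {2..n}"
      by (simp add: Alt_on_def permutations_of_set_def)
    then obtain w'' where w'': "w'' \<in> And_on {2..n}" "v'' = eta_on False {2..n} w''"
      using bij_betw_imp_surj_on[OF eta_on_facts(1)[OF atLeast2_psubset, of False]] by blast
    then have "set w'' = {2..n}" "andre_I w''"
      by (auto simp: And_on_def permutations_of_set_def)
    then have "1 # w'' \<in> And_I n"
      using And_I_append_iff[OF n, of "[]" w''] n andre_I.empty by simp
    then show ?thesis using eta_Cons_1(1) w''(2) vs by (metis image_eqI)
  next
    case False
    let ?P = "\<lambda>x. x \<noteq> 1 \<and> x \<noteq> n"
    define v' where "v' = takeWhile ?P v"
    define v'' where "v'' = dropWhile ?P v"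
    define b where "b = even (length v')"
    have vs: "v = v' @ v''" by (simp add: v'_def v''_def)
    have P': "?P x" if "x \<in> set v'" for x
      using that unfolding v'_def by (auto dest: set_takeWhileD)
    have in'': "1 \<in> set v''" "n \<in> set v''"
    proof -
      have "1 \<in> set v" "n \<in> set v" unfolding sv using n by simp_all
      then show "1 \<in> set v''" "n \<in> set v''" using P' vs by auto
    qed
    then have ne'': "v'' \<noteq> []" by auto
    have hd'': "hd v'' = 1 \<or> hd v'' = n"
      using hd_dropWhile[of ?P v] ne'' unfolding v''_def by blast
    \<comment> \<open>The word opens with an ascent, so its first letter is not \<open>n\<close>; it
      is not 1 in this case, hence the left piece is nonempty.\<close>
    obtain x y zs where xy: "v = x # y # zs"
      using lv n by (cases v rule: remdups_adj.cases) auto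
    have "x < y" using zv xy by simp
    moreover have "y \<le> n" using sv xy by auto
    ultimately have ne': "v' \<noteq> []" using False unfolding v'_def xy by simp
    have s': "set v' \<subseteq> {1<..<n}"
    proof
      fix z assume z: "z \<in> set v'"
      then have "z \<in> {1..n}" using sv vs by auto
      with P'[OF z] show "z \<in> {1<..<n}" by auto
    qed
    have last: "last v' \<in> {1<..<n}" using s' ne' last_in_set by blast
    have Z: "zigzag True v'" "if b then hd v'' < last v' else last v' < hd v''" "zigzag b v''"
      using zv unfolding vs zigzag_append[OF ne' ne''] b_def by auto
    \<comment> \<open>A descent from a letter below \<open>n\<close> cannot reach \<open>n\<close>,
      and an ascent from a letter above 1 cannot reach 1, so the parity selects the letter.\<close>
    have hdb: "hd v'' = (if b then 1 else n)"
      using Z(2) last hd'' by (auto split: if_splits)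
    have A: "v' \<in> Alt_on True (set v')" "v'' \<in> Alt_on b (set v'')"
      using Z dv vs by (auto simp: Alt_on_def permutations_of_set_def)
    have p1: "set v' \<subset> {1..n}" using s' by (rule psubset_if_subset_interior)
    have "hd v' \<in> set v'" using ne' by simp
    then have "hd v' \<notin> set v''" using dv vs by auto
    then have p2: "set v'' \<subset> {1..n}" using sv vs \<open>hd v' \<in> set v'\<close> by auto
    have ne: "set v' \<noteq> {}" "set v'' \<noteq> {}" using ne' ne'' by auto
    obtain w' where w': "w' \<in> And_on (set v')" "v' = eta_on True (set v') w'"
      using bij_betw_imp_surj_on[OF eta_on_facts(1)[OF p1 ne(1), of True]] A(1) by blast
    obtain u where u: "u \<in> And_on (set v'')" "v'' = eta_on b (set v'') u"
      using bij_betw_imp_surj_on[OF eta_on_facts(1)[OF p2 ne(2), of b]] A(2) by blast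
    \<comment> \<open>For a true flag first letters are preserved. For a false flag the image starts
      with the maximum \<open>n\<close> of its alphabet, so \<open>u\<close> starts with the
      minimum, which is 1.\<close>
    have "hd u = 1"
    proof (cases b)
      case True
      then show ?thesis using eta_on_facts(2)[OF p2 ne(2) u(1)] u(2) hdb by simp
    next
      case False
      have "Max (set v'') = n"
        using p2 in''(2) by (intro Max_eqI) auto
      moreover have "Min (set v'') = 1"
        using p2 in''(1) by (intro Min_eqI) auto
      ultimately show ?thesis
        using eta_on_facts(3)[OF p2 ne(2) u(1)] u(2) hdb False by simp
    qed
    moreover have us: "set u = set v''" "distinct u" "andre_I u"
      using u(1) by (auto simp: And_on_def permutations_of_set_def)
    ultimately obtain w'' where uw: "u = 1 # w''" using ne(2) by (cases u) auto
    have ws: "set w' = set v'" "distinct w'" "andre_I w'"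
      using w'(1) by (auto simp: And_on_def permutations_of_set_def)
    have len: "length w' = length v'"
      using ws(1,2) dv vs by (metis distinct_append distinct_card)
    have sw'': "set w'' = set v'' - {1}"
      unfolding us(1)[symmetric] using us(2) uw by simp
    have n'': "n \<in> set w''" unfolding sw'' using in''(2) n by simp
    have gt: "\<forall>x\<in>set w''. 1 < x"
      using p2 unfolding sw'' by fastforce
    have "w'' \<noteq> []" using n'' by auto
    then have "andre_I w''"
      using andre_I_Cons_1[of w''] us(3) uw gt by blast
    moreover have "set w' \<inter> set w'' = {}"
      using ws(1) sw'' dv vs by auto
    moreover have "set w' \<union> set w'' = {2..n}"
    proof -
      have "set w' \<union> set w'' = set v - {1}"
        unfolding ws(1) sw'' using vs P' by auto
      also have "\<dots> = {2..n}" unfolding sv by auto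
      finally show ?thesis .
    qed
    ultimately have w: "w' @ 1 # w'' \<in> And_I n"
      using And_I_append_iff[OF n] ws(3) n'' by blast
    have "w' \<noteq> []" using len ne' by auto
    \<comment> \<open>Equal lengths of \<open>w'\<close> and \<open>v'\<close> ensure that the
      recursion picks the flag \<open>b\<close> for the second block.\<close>
    then have "eta (w' @ 1 # w'') = v"
      using eta_append[OF n w] w'(2) u(2) ws(1) us(1) uw len vs by (simp add: b_def)
    with w show ?thesis by blast
  qed
qed

lemma eta_step: "bij_betw eta (And_I n) (Alt n) \<and> (\<forall>w\<in>And_I n. hd w = hd (eta w))"
  using inj_on_eta_step eta_in_Alt eta_surj_step hd_eta_step by (auto simp: bij_betw_def)

end

section \<open>Strong induction on \<open>n\<close>, started at the one-letter word\<close>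

theorem theorem2p2:
  fixes n :: nat
  assumes "1 \<le> n"
  shows "bij_betw eta (And_I n) (Alt n) \<and> (\<forall>w\<in>And_I n. hd w = hd (eta w))"
  using assms
proof (induction n rule: less_induct)
  case (less n)
  show ?case
  proof (cases "n = 1")
    case True
    have p: "permutations_of_set {1..1::nat} = {[1]}" by simp
    have "andre_I [1]" by (auto intro: andre_I.single simp: is_word_def)
    then have "And_I 1 = {[1]}" "Alt 1 = {[1]}"
      unfolding And_I_def Alt_def p by auto
    with True eta_base(1) show ?thesis by (simp add: bij_betw_def)
  next
    case False
    with less show ?thesis by (intro eta_step) auto
  qed
qed

end
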